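(* Let $a,b,c\in\mathbb{C}$. The following integral representations hold under the indicated conditions. (1) For $x<1$, $\operatorname{Re}c>\operatorname{Re}b>0$: $$w_1(x;a,b,c)=\frac{\Gamma(c)}{\Gamma(b)\Gamma(c-b)}\int_1^\infty y^{a-c}(y-1)^{c-b-1}(y-x)^{-a}dy.$$ (2) For $x\in(-\infty,0)\cup(0,1)$, $2>\operatorname{Re}(a+1)>\operatorname{Re}c$: $$w_2(x;a,b,c)=\frac{\Gamma(2-c)}{\Gamma(a-c+1)\Gamma(1-a)}\int_{0<y/x<1}|y|^{a-c}(1-y)^{c-b-1}|x-y|^{-a}dy.$$ (3) For $x\in(-\infty,0)\cup(1,\infty)$, $\operatorname{Re}(a+1)>\operatorname{Re}c>\operatorname{Re}b$: $$w_3(x;a,b,c)=\frac{\Gamma(a-b+1)}{\Gamma(a-c+1)\Gamma(c-b)}\int_0^1y^{a-c}(1-y)^{c-b-1}|x-y|^{-a}dy.$$ (4) For $x\in(-\infty,0)\cup(1,\infty)$, $\operatorname{Re}a<1$, $\operatorname{Re}b>0$: $$w_4(x;a,b,c)=\frac{\Gamma(b-a+1)}{\Gamma(1-a)\Gamma(b)}\int_{y/x>1}|y|^{a-c}|y-1|^{c-b-1}|y-x|^{-a}dy.$$ (5) For $x\in(0,\infty)$, $\operatorname{Re}b>0$, $\operatorname{Re}(a+1)>\operatorname{Re}c$: $$w_5(x;a,b,c)=\frac{\Gamma(a+b-c+1)}{\Gamma(a-c+1)\Gamma(b)}\int_{-\infty}^0(-y)^{a-c}(1-y)^{c-b-1}(x-y)^{-a}dy.$$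 (6) For $x\in(0,1)\cup(1,\infty)$, $\operatorname{Re}(c-b)>0$, $\operatorname{Re}a<1$: $$w_6(x;a,b,c)=\frac{\Gamma(c-a-b+1)}{\Gamma(1-a)\Gamma(c-b)}\int_{0<\frac{1-y}{1-x}<1}|y|^{a-c}|1-y|^{c-b-1}|x-y|^{-a}dy.$$
   Context: Write $F(a,b;c;z)={}_2F_1(a,b;c;z)$ for the Gauss hypergeometric function (power series for $|z|<1$, analytically continued to $\mathbb{C}\setminus[1,\infty)$, with $c\notin\mathbb{Z}_{\le0}$). The six solutions of the hypergeometric differential equation on real intervals are $w_1(x;a,b,c)=F(a,b;c;x)$ for $x\in(-\infty,1)$; $w_2(x;a,b,c)=|x|^{1-c}F(a-c+1,b-c+1;2-c;x)$ for $x\in(-\infty,0)\cup(0,1)$; $w_3(x;a,b,c)=|x|^{-a}F(a,a-c+1;a-b+1;x^{-1})$ for $x\in(-\infty,0)\cup(1,\infty)$; $w_4(x;a,b,c)=|x|^{-b}F(b,b-c+1;b-a+1;x^{-1})$ for $x\in(-\infty,0)\cup(1,\infty)$; $w_5(x;a,b,c)=F(a,b;a+b-c+1;1-x)$ for $x\in(0,\infty)$; $w_6(x;a,b,c)=|1-x|^{c-a-b}F(c-a,c-b;c-a-b+1;1-x)$ for $x\in(0,1)\cup(1,\infty)$. Integrals over sets such as $0<y/x<1$ are Lebesgue integrals over the set of real $y$ satisfying the condition (with $x$ fixed). *)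

theory Defs
  imports "HOL-Complex_Analysis.Complex_Analysis"
begin

definition slit_plane :: "complex set" where
  "slit_plane = - (complex_of_real ` {1..})"

text \<open>
  Only the values on \<^const>\<open>slit_plane\<close> are meaningful, and only for \<open>c\<close> not a
  non-positive integer; there the choice is unique, see \<open>gauss_2F1_eqI\<close> below.
\<close>

definition gauss_2F1 :: "complex \<Rightarrow> complex \<Rightarrow> complex \<Rightarrow> complex \<Rightarrow> complex" where
  "gauss_2F1 a b c = (SOME f. f holomorphic_on slit_plane \<and>
     (\<forall>z\<in>ball 0 1. f z = eval_fps (fps_hypergeo [a, b] [c] 1) z))"

lemma eval_fps_hypergeo_2_1:
  fixes a b c z :: complex
  shows "eval_fps (fps_hypergeo [a, b] [c] 1) z =
    (\<Sum>n. pochhammer a n * pochhammer b n / (pochhammer c n * fact n) * z ^ n)"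
  by (simp add: eval_fps_def)

lemma slit_plane_altdef: "slit_plane = - {z. Im z = 0 \<and> 1 \<le> Re z}"
proof -
  have "z \<in> complex_of_real ` {1..}" if "Im z = 0" "1 \<le> Re z" for z
    using that by (intro image_eqI[of _ _ "Re z"]) (auto simp: complex_eq_iff)
  then show ?thesis
    unfolding slit_plane_def by auto
qed

lemma open_slit_plane: "open slit_plane"
proof -
  have "closed {z. Im z = 0 \<and> 1 \<le> Re z}"
    by (intro closed_Collect_conj closed_Collect_eq closed_Collect_le continuous_intros)
  then show ?thesis
    unfolding slit_plane_altdef by (simp add: open_Compl)
qed

lemma ball_subset_slit_plane: "ball 0 1 \<subseteq> slit_plane"
proof
  fix z :: complex assume "z \<in> ball 0 1"
  then show "z \<in> slit_plane"
    using complex_Re_le_cmod[of z] unfolding slit_plane_altdef by auto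
qed

lemma connected_slit_plane: "connected slit_plane"
proof -
  have "closed_segment 0 z \<subseteq> slit_plane" if z: "z \<in> slit_plane" for z
  proof
    fix w assume "w \<in> closed_segment 0 z"
    then obtain u where u: "0 \<le> u" "u \<le> 1" "w = u *\<^sub>R z"
      by (auto simp: in_segment)
    show "w \<in> slit_plane"
    proof (rule ccontr)
      assume "w \<notin> slit_plane"
      then have w: "u * Im z = 0" "1 \<le> u * Re z"
        using u by (auto simp: slit_plane_altdef)
      then have "u \<noteq> 0" by auto
      then have "Im z = 0" using w by simp
      moreover have "0 < Re z"
        using w u by (metis mult_nonneg_nonpos not_le not_one_le_zero order_trans)
      then have "u * Re z \<le> Re z"
        using u by (simp add: mult_left_le_one_le)
      ultimately show False
        using z w by (auto simp: slit_plane_altdef)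
    qed
  qed
  moreover have "0 \<in> slit_plane" by (simp add: slit_plane_altdef)
  ultimately have "starlike slit_plane"
    unfolding starlike_def by blast
  then show ?thesis by (rule starlike_imp_connected)
qed

lemma gauss_2F1_eqI:
  assumes f: "f holomorphic_on slit_plane"
    and f_eq: "\<And>z. norm z < 1 \<Longrightarrow> f z = eval_fps (fps_hypergeo [a, b] [c] 1) z"
    and z: "z \<in> slit_plane"
  shows "gauss_2F1 a b c z = f z"
proof -
  let ?P = "\<lambda>f. f holomorphic_on slit_plane \<and>
     (\<forall>z\<in>ball 0 1. f z = eval_fps (fps_hypergeo [a, b] [c] 1) z)"
  have "?P f" using f f_eq by auto
  then have P: "?P (gauss_2F1 a b c)"
    unfolding gauss_2F1_def by (rule someI[where P = ?P])
  show ?thesis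
  proof (rule analytic_continuation_open[of "ball 0 1" slit_plane "gauss_2F1 a b c" f])
    show "gauss_2F1 a b c w = f w" if "w \<in> ball 0 1" for w
      using P f_eq[of w] that by auto
  qed (use P f z open_slit_plane connected_slit_plane ball_subset_slit_plane in auto)
qed

definition hyp_w1 :: "real \<Rightarrow> complex \<Rightarrow> complex \<Rightarrow> complex \<Rightarrow> complex" where
  "hyp_w1 x a b c = gauss_2F1 a b c (of_real x)"

definition hyp_w2 :: "real \<Rightarrow> complex \<Rightarrow> complex \<Rightarrow> complex \<Rightarrow> complex" where
  "hyp_w2 x a b c =
     of_real \<bar>x\<bar> powr (1 - c) * gauss_2F1 (a - c + 1) (b - c + 1) (2 - c) (of_real x)"

definition hyp_w3 :: "real \<Rightarrow> complex \<Rightarrow> complex \<Rightarrow> complex \<Rightarrow> complex" where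
  "hyp_w3 x a b c =
     of_real \<bar>x\<bar> powr (- a) * gauss_2F1 a (a - c + 1) (a - b + 1) (of_real (inverse x))"

definition hyp_w4 :: "real \<Rightarrow> complex \<Rightarrow> complex \<Rightarrow> complex \<Rightarrow> complex" where
  "hyp_w4 x a b c =
     of_real \<bar>x\<bar> powr (- b) * gauss_2F1 b (b - c + 1) (b - a + 1) (of_real (inverse x))"

definition hyp_w5 :: "real \<Rightarrow> complex \<Rightarrow> complex \<Rightarrow> complex \<Rightarrow> complex" where
  "hyp_w5 x a b c = gauss_2F1 a b (a + b - c + 1) (of_real (1 - x))"

definition hyp_w6 :: "real \<Rightarrow> complex \<Rightarrow> complex \<Rightarrow> complex \<Rightarrow> complex" where
  "hyp_w6 x a b c =
     of_real \<bar>1 - x\<bar> powr (c - a - b) *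
     gauss_2F1 (c - a) (c - b) (c - a - b + 1) (of_real (1 - x))"

end

theory Submission
  imports Defs
begin

text \<open>
  Each of the six integrals is carried by a substitution \<open>y = g t\<close> (\<open>1/t\<close>, \<open>x t\<close>, \<open>t\<close>, \<open>x/t\<close>,
  \<open>1 - 1/t\<close>, \<open>1 - (1 - x) t\<close>) to an Euler integral
  \<open>\<integral>\<^sub>0\<^sup>1 t\<^bsup>p-1\<^esup> (1-t)\<^bsup>q-1\<^esup> (1-zt)\<^bsup>-a\<^esup> dt = B(p,q) F(a,p;p+q;z)\<close>.
  Both sides of Euler's formula are holomorphic on the slit plane, so it is enough to
  check it for \<open>|z| < 1\<close>, where one expands \<open>(1-zt)\<^bsup>-a\<^esup>\<close> by the binomial series and integrates
  termwise. The complex Beta integral needed there follows from the real one by analytic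
  continuation, first in \<open>p\<close> and then in \<open>q\<close>.
\<close>

section \<open>Holomorphic dependence of integrals on a parameter\<close>

text \<open>Differentiation under the integral sign with only a local majorant of \<open>f\<close>
  itself: Cauchy's inequality turns it into a bound on the derivative in a smaller disc, hence on
  difference quotients, and dominated convergence then yields the complex derivative.\<close>

lemma holomorphic_on_integral:
  fixes f :: "complex \<Rightarrow> 'a \<Rightarrow> complex"
  assumes meas: "\<And>z. z \<in> U \<Longrightarrow> f z \<in> borel_measurable M"
    and hol: "\<And>x. x \<in> space M \<Longrightarrow> (\<lambda>z. f z x) holomorphic_on U"
    and dom: "\<And>z. z \<in> U \<Longrightarrow> \<exists>r>0. \<exists>g. cball z r \<subseteq> U \<and> integrable M g \<and>
                (\<forall>w\<in>cball z r. \<forall>x\<in>space M. norm (f w x) \<le> g x)"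
  shows "(\<lambda>z. integral\<^sup>L M (f z)) holomorphic_on U"
  unfolding holomorphic_on_def
proof
  fix z assume z: "z \<in> U"
  obtain r g where r: "r > 0" "cball z r \<subseteq> U" and g: "integrable M g"
    and fg: "\<And>w x. w \<in> cball z r \<Longrightarrow> x \<in> space M \<Longrightarrow> norm (f w x) \<le> g x"
    using dom[OF z] by blast
  have int: "integrable M (f w)" if "w \<in> cball z r" for w
    using that r g fg by (intro Bochner_Integration.integrable_bound[OF g])
      (auto intro!: meas AE_I2 order.trans[OF fg])
  define f' where "f' = (\<lambda>x. deriv (\<lambda>z. f z x) z)"
  have der: "((\<lambda>w. f w x) has_field_derivative deriv (\<lambda>z. f z x) w) (at w)"
    if "w \<in> ball z r" "x \<in> space M" for w x
  proof (rule holomorphic_derivI)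
    show "(\<lambda>w. f w x) holomorphic_on ball z r"
      by (rule holomorphic_on_subset[OF hol[OF that(2)]]) (use r in auto)
  qed (use that in auto)
  have bound: "norm ((f w x - f z x) / (w - z)) \<le> 2 / r * g x"
    if w: "w \<in> ball z (r / 2)" and x: "x \<in> space M" for w x
  proof -
    \<comment> \<open>Halving the radius leaves room for a disc of radius r/2 about every such
      \<open>u\<close> inside \<open>cball z r\<close>, where the majorant is valid; Cauchy's
      inequality on that disc produces the factor 2/r.\<close>
    have "norm (deriv (\<lambda>z. f z x) u) \<le> 2 / r * g x" if u: "u \<in> ball z (r / 2)" for u
    proof -
      have sub: "cball u (r / 2) \<subseteq> cball z r"
      proof
        fix v assume "v \<in> cball u (r / 2)"
        then show "v \<in> cball z r"
          using u dist_triangle[of z v u] by auto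
      qed
      have hu: "(\<lambda>z. f z x) holomorphic_on cball u (r / 2)"
        by (rule holomorphic_on_subset[OF hol[OF x]]) (use sub r in auto)
      have "norm ((deriv ^^ 1) (\<lambda>z. f z x) u) \<le> fact 1 * g x / (r / 2) ^ 1"
      proof (rule Cauchy_inequality)
        show "continuous_on (cball u (r / 2)) (\<lambda>z. f z x)"
          using hu by (rule holomorphic_on_imp_continuous_on)
        show "(\<lambda>z. f z x) holomorphic_on ball u (r / 2)"
          using hu ball_subset_cball by (rule holomorphic_on_subset)
        show "norm (f v x) \<le> g x" if "norm (u - v) = r / 2" for v
        proof -
          have "v \<in> cball u (r / 2)"
            using that by (simp add: dist_norm)
          then show ?thesis
            using sub fg x by blast
        qed
      qed (use r in auto)
      then show ?thesis by (simp add: field_simps)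
    qed
    note deriv_bound = this
    have "norm (f w x - f z x) \<le> 2 / r * g x * norm (w - z)"
    proof (intro field_differentiable_bound[of "ball z (r / 2)"])
      show "((\<lambda>w. f w x) has_field_derivative deriv (\<lambda>z. f z x) u) (at u within ball z (r / 2))"
        if "u \<in> ball z (r / 2)" for u
        using der[of u x] that r x by (auto intro: has_field_derivative_at_within)
    qed (use w r deriv_bound in auto)
    \<comment> \<open>For w = z the quotient is a division by zero, hence 0, and the bound comes
      down to this sign condition.\<close>
    moreover have "0 \<le> g x"
      using order.trans[OF norm_ge_zero fg[of z x]] x r by simp
    ultimately show ?thesis
      using r by (cases "w = z") (simp_all add: norm_divide pos_divide_le_eq)
  qed
  have lim: "((\<lambda>w. (f w x - f z x) / (w - z)) \<longlongrightarrow> f' x) (at z)" if "x \<in> space M" for x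
    using der[of z x] that r by (simp add: f'_def has_field_derivative_iff)
  have "((\<lambda>w. (integral\<^sup>L M (f w) - integral\<^sup>L M (f z)) / (w - z)) \<longlongrightarrow> integral\<^sup>L M f') (at z)"
    unfolding tendsto_at_iff_sequentially
  proof (intro allI impI)
    fix X :: "nat \<Rightarrow> complex"
    assume X: "\<forall>n. X n \<in> UNIV - {z}" "X \<longlonglongrightarrow> z"
    have "eventually (\<lambda>n. X n \<in> ball z (r / 2)) sequentially"
      using X(2) r by (intro topological_tendstoD) auto
    then obtain N where N: "\<And>n. n \<ge> N \<Longrightarrow> X n \<in> ball z (r / 2)"
      by (auto simp: eventually_sequentially)
    \<comment> \<open>Dominated convergence wants the majorant for every term, so the finitely many
      terms of \<open>X\<close> outside the small disc are shifted away;
      \<open>LIMSEQ_offset\<close> restores them at the end.\<close>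
    define Y where "Y = (\<lambda>n. X (n + N))"
    have Y: "Y n \<in> ball z (r / 2)" "Y n \<in> ball z r" "Y n \<noteq> z" for n
      using N[of "n + N"] X(1) r by (auto simp: Y_def)
    have YU: "Y n \<in> U" "Y n \<in> cball z r" for n
      using Y(2)[of n] r by auto
    have "Y \<longlonglongrightarrow> z"
      unfolding Y_def using X(2) by (rule LIMSEQ_ignore_initial_segment)
    then have Ylim: "(\<lambda>n. (f (Y n) x - f z x) / (Y n - z)) \<longlonglongrightarrow> f' x" if "x \<in> space M" for x
      using lim[OF that] Y(3) unfolding tendsto_at_iff_sequentially o_def by auto
    have Ymeas: "(\<lambda>x. (f (Y n) x - f z x) / (Y n - z)) \<in> borel_measurable M" for n
      using meas[OF z] meas[OF YU(1)] by measurable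
    have "(\<lambda>n. integral\<^sup>L M (\<lambda>x. (f (Y n) x - f z x) / (Y n - z))) \<longlonglongrightarrow> integral\<^sup>L M f'"
    proof (rule integral_dominated_convergence)
      show "f' \<in> borel_measurable M"
        using Ylim Ymeas by (rule borel_measurable_LIMSEQ_metric[rotated])
      show "integrable M (\<lambda>x. 2 / r * g x)"
        using g by simp
    qed (use Ylim Ymeas bound Y in auto)
    also have "(\<lambda>n. integral\<^sup>L M (\<lambda>x. (f (Y n) x - f z x) / (Y n - z))) =
        (\<lambda>n. (integral\<^sup>L M (f (Y n)) - integral\<^sup>L M (f z)) / (Y n - z))"
      using int YU(2) r by (intro ext) simp
    finally show "((\<lambda>w. (integral\<^sup>L M (f w) - integral\<^sup>L M (f z)) / (w - z)) \<circ> X) \<longlonglongrightarrow> integral\<^sup>L M f'"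
      unfolding Y_def o_def by (rule LIMSEQ_offset)
  qed
  then have "((\<lambda>z. integral\<^sup>L M (f z)) has_field_derivative integral\<^sup>L M f') (at z)"
    by (simp add: has_field_derivative_iff)
  then show "(\<lambda>z. integral\<^sup>L M (f z)) field_differentiable at z within U"
    using field_differentiable_at_within field_differentiable_def by blast
qed

section \<open>Change of variables for Lebesgue integrals over sets\<close>

text \<open>The change-of-variables theorem speaks of absolute integrability with respect to the
  completed measure. The pullback \<open>k\<close> is moved to the completion, the theorem applied
  there, and the result brought back to \<open>lborel\<close> because \<open>f\<close> is Borel.
  Integrability of \<open>f\<close> is thus a conclusion, inherited from \<open>k\<close>.\<close>

lemma set_integral_substitution:
  fixes f :: "real \<Rightarrow> complex" and g h :: "real \<Rightarrow> real"
  assumes S: "S \<in> sets borel" "g ` S = T" "T \<in> sets borel"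
    and f: "f \<in> borel_measurable borel"
    and der: "\<And>x. x \<in> S \<Longrightarrow> (g has_real_derivative h x) (at x)"
    and inj: "inj_on g S"
    and eq: "\<And>x. x \<in> S \<Longrightarrow> of_real \<bar>h x\<bar> * f (g x) = k x"
    and int: "set_integrable lborel S k"
  shows "set_integrable lborel T f" "(LINT y:T|lborel. f y) = (LINT x:S|lborel. k x)"
proof -
  have k: "k absolutely_integrable_on S"
    using int unfolding set_integrable_def absolutely_integrable_on_def
    by (intro integrable_completion[THEN iffD2]) auto
  have eq': "\<bar>h x\<bar> *\<^sub>R f (g x) = k x" if "x \<in> S" for x
    using eq[OF that] by (simp add: scaleR_conv_of_real)
  have "(\<lambda>x. \<bar>h x\<bar> *\<^sub>R f (g x)) absolutely_integrable_on S"
    using k by (rule set_integrable_cong[THEN iffD1, rotated -1]) (auto simp: eq')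
  moreover have "integral S (\<lambda>x. \<bar>h x\<bar> *\<^sub>R f (g x)) = integral S k"
    by (intro integral_cong) (auto simp: eq')
  ultimately have *: "f absolutely_integrable_on T" "integral T f = integral S k"
    using has_absolute_integral_change_of_variables_real[of S g h f "integral S k"] S der inj
    by (auto intro: has_field_derivative_at_within)
  show **: "set_integrable lborel T f"
  proof -
    have "(\<lambda>x. indicator T x *\<^sub>R f x) \<in> borel_measurable lborel"
      using S(3) f by simp
    then show ?thesis
      using *(1) integrable_completion[of "\<lambda>x. indicator T x *\<^sub>R f x" lborel]
      unfolding set_integrable_def by blast
  qed
  show "(LINT y:T|lborel. f y) = (LINT x:S|lborel. k x)"
    using set_borel_integral_eq_integral(2)[OF **] set_borel_integral_eq_integral(2)[OF int] *(2) by simp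
qed

section \<open>The complex Beta integral\<close>

lemma integrable_Beta_Ioo:
  fixes p q :: real
  assumes "p > 0" "q > 0"
  shows "set_integrable lborel {0<..<1} (\<lambda>t. t powr (p - 1) * (1 - t) powr (q - 1))"
  by (rule set_integrable_subset[OF integrable_Beta[OF assms]]) auto

lemma integrable_Beta_complex:
  fixes p q :: complex
  assumes "Re p > 0" "Re q > 0"
  shows "set_integrable lborel {0<..<1}
           (\<lambda>t. of_real t powr (p - 1) * of_real (1 - t) powr (q - 1))"
  using integrable_Beta_Ioo[OF assms] unfolding set_integrable_def
proof (rule Bochner_Integration.integrable_bound)
  show "AE t in lborel.
      norm (indicator {0<..<1} t *\<^sub>R (complex_of_real t powr (p - 1) * complex_of_real (1 - t) powr (q - 1)))
      \<le> norm (indicator {0<..<1} t *\<^sub>R (t powr (Re p - 1) * (1 - t) powr (Re q - 1)))"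
    by (intro AE_I2) (auto simp: indicator_def norm_mult norm_powr_real_powr)
qed measurable

lemma set_integral_Beta_real:
  fixes p q :: real
  assumes "p > 0" "q > 0"
  shows "(LINT t:{0<..<1}|lborel. complex_of_real t powr (of_real p - 1) * complex_of_real (1 - t) powr (of_real q - 1)) =
           Beta (of_real p) (of_real q)"
proof -
  have "(LINT t:{0<..<1}|lborel. t powr (p - 1) * (1 - t) powr (q - 1)) = Beta p q"
    using set_borel_integral_eq_integral(2)[OF integrable_Beta_Ioo[OF assms]]
      has_integral_Beta_real[OF assms] by (simp add: has_integral_Icc_iff_Ioo integral_unique)
  then have "Beta (of_real p) (of_real q) =
      complex_of_real (LINT t:{0<..<1}|lborel. t powr (p - 1) * (1 - t) powr (q - 1))"
    by (simp add: Beta_complex_of_real)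
  also have "\<dots> = (LINT t:{0<..<1}|lborel. complex_of_real (t powr (p - 1) * (1 - t) powr (q - 1)))"
    by (rule set_integral_complex_of_real[symmetric])
  also have "\<dots> = (LINT t:{0<..<1}|lborel. complex_of_real t powr (of_real p - 1) * complex_of_real (1 - t) powr (of_real q - 1))"
    by (intro set_lebesgue_integral_cong) (auto simp flip: powr_of_real)
  finally show ?thesis ..
qed

text \<open>The identity theorem: the half-plane is connected and the positive reals accumulate at
  its point 1.\<close>

lemma holomorphic_eq_on_right_halfplane:
  assumes f: "f holomorphic_on {z. Re z > 0}" and g: "g holomorphic_on {z. Re z > 0}"
    and eq: "\<And>x. x > 0 \<Longrightarrow> f (complex_of_real x) = g (of_real x)" and z: "Re z > 0"
  shows "f z = g z"
proof -
  have "f z - g z = 0"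
  proof (rule analytic_continuation[of "\<lambda>z. f z - g z" "{z. Re z > 0}" "complex_of_real ` {0<..}" 1])
    show "connected {z. Re z > 0}"
      by (intro convex_connected convex_halfspace_Re_gt)
    show "(1::complex) islimpt complex_of_real ` {0<..}"
      unfolding islimpt_approachable
    proof (intro allI impI)
      fix e :: real assume "e > 0"
      then show "\<exists>x'\<in>complex_of_real ` {0<..}. x' \<noteq> 1 \<and> dist x' 1 < e"
        by (intro bexI[of _ "of_real (1 + e / 2)"] image_eqI[OF refl])
           (simp_all add: dist_norm norm_divide)
    qed
  qed (use f g eq z in \<open>auto intro!: holomorphic_intros open_halfspace_Re_gt\<close>)
  then show ?thesis by simp
qed

lemma Re_pos_not_nonpos_Ints: "Re z > 0 \<Longrightarrow> z \<notin> \<int>\<^sub>\<le>\<^sub>0"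
  by (auto elim!: nonpos_Ints_cases)

lemma Gamma_nonzero_right_halfplane: "Re z > 0 \<Longrightarrow> Gamma z \<noteq> 0"
  by (simp add: Gamma_eq_zero_iff Re_pos_not_nonpos_Ints)

lemma holomorphic_on_Beta:
  assumes "Re q > 0"
  shows "(\<lambda>p. Beta p q) holomorphic_on {p. Re p > 0}"
  unfolding Beta_altdef using assms
  by (auto intro!: holomorphic_intros dest: Re_pos_not_nonpos_Ints)

text \<open>On the disc of radius r = Re p / 2 about p all real parts are at least r, and since t <
  1 the power \<open>t powr (r - 1)\<close> dominates there, leaving a convergent real Beta
  integrand as majorant.\<close>

lemma holomorphic_on_Beta_integral:
  assumes "Re q > 0"
  shows "(\<lambda>p. LINT t:{0<..<1}|lborel. of_real t powr (p - 1) * of_real (1 - t) powr (q - 1))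
           holomorphic_on {p. Re p > 0}"
  unfolding set_lebesgue_integral_def
proof (rule holomorphic_on_integral, goal_cases)
  case (1 p)
  show ?case by measurable
next
  case (2 t)
  show ?case
    by (cases "t \<in> {0<..<1}")
       (auto intro!: holomorphic_intros simp: complex_nonpos_Reals_iff)
next
  case (3 p)
  define r where "r = Re p / 2"
  have r: "r > 0" using 3 by (simp add: r_def)
  have Re_ge: "Re w \<ge> r" if "w \<in> cball p r" for w
    using that complex_Re_le_cmod[of "p - w"] by (simp add: dist_norm r_def)
  show ?case
  proof (intro exI conjI ballI)
    show "r > 0" by fact
    show "cball p r \<subseteq> {p. Re p > 0}"
      using Re_ge r by force
    show "integrable lborel (\<lambda>t. indicator {0<..<1} t *\<^sub>R (t powr (r - 1) * (1 - t) powr (Re q - 1)))"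
      using integrable_Beta_Ioo[OF r assms] by (simp only: set_integrable_def)
    fix w t assume w: "w \<in> cball p r"
    show "norm (indicator {0<..<1} t *\<^sub>R (complex_of_real t powr (w - 1) * complex_of_real (1 - t) powr (q - 1)))
        \<le> indicator {0<..<1} t *\<^sub>R (t powr (r - 1) * (1 - t) powr (Re q - 1))"
      using Re_ge[OF w]
      by (auto simp: indicator_def norm_mult norm_powr_real_powr intro!: mult_right_mono powr_mono')
  qed
qed

text \<open>Reflection t -> 1 - t. It lets holomorphy in the first parameter also serve for
  continuation in the second.\<close>

lemma set_integral_Beta_commute:
  "(LINT t:{0<..<1}|lborel. complex_of_real t powr (p - 1) * of_real (1 - t) powr (q - 1)) =
   (LINT t:{0<..<1}|lborel. of_real t powr (q - 1) * of_real (1 - t) powr (p - 1))"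
proof -
  \<comment> \<open>The reflection is spelled \<open>1 + (-1) * t\<close> to fit the affine change
    of variables with slope -1 and offset 1, whose Jacobian is 1.\<close>
  have "(LINT t:{0<..<1}|lborel. complex_of_real t powr (p - 1) * of_real (1 - t) powr (q - 1)) =
    integral\<^sup>L lborel (\<lambda>t. indicator {0<..<1} (1 + (-1) * t) *\<^sub>R
      (complex_of_real (1 + (-1) * t) powr (p - 1) * of_real (1 - (1 + (-1) * t)) powr (q - 1)))"
    unfolding set_lebesgue_integral_def by (subst lborel_integral_real_affine[of "-1" _ 1]) auto
  also have "\<dots> = (LINT t:{0<..<1}|lborel. of_real t powr (q - 1) * of_real (1 - t) powr (p - 1))"
    unfolding set_lebesgue_integral_def
    by (intro Bochner_Integration.integral_cong) (auto simp: indicator_def)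
  finally show ?thesis .
qed

lemma set_integral_Beta:
  fixes p q :: complex
  assumes "Re p > 0" "Re q > 0"
  shows "(LINT t:{0<..<1}|lborel. of_real t powr (p - 1) * of_real (1 - t) powr (q - 1)) = Beta p q"
proof -
  \<comment> \<open>With \<open>q\<close> a positive real, both sides agree at positive real
    \<open>p\<close> by the real Beta integral, which starts the continuation in
    \<open>p\<close>.\<close>
  have *: "(LINT t:{0<..<1}|lborel. of_real t powr (p - 1) * of_real (1 - t) powr (of_real q - 1)) =
      Beta p (of_real q)" if "Re p > 0" "q > 0" for p and q :: real
    by (rule holomorphic_eq_on_right_halfplane[OF holomorphic_on_Beta_integral holomorphic_on_Beta _ that(1)])
       (use that set_integral_Beta_real in auto)
  \<comment> \<open>Now \<open>p\<close> is a fixed complex number and \<open>q\<close>, moved into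
    first position, is the variable; at real \<open>q\<close> the previous fact, read through the
    symmetry, gives equality.\<close>
  have "(LINT t:{0<..<1}|lborel. of_real t powr (q - 1) * of_real (1 - t) powr (p - 1)) = Beta q p"
    by (rule holomorphic_eq_on_right_halfplane[OF holomorphic_on_Beta_integral holomorphic_on_Beta _ assms(2)])
       (use assms * in \<open>simp_all only: set_integral_Beta_commute[where q = p] Beta_commute[where b = p]\<close>)
  then show ?thesis
    by (simp only: set_integral_Beta_commute[of p q] Beta_commute[of p q])
qed

section \<open>Convergence and holomorphy of Euler's integral on the slit plane\<close>

text \<open>If 1 - zt were real and at most 0, then zt would be real and at least 1, so z would be
  real with z >= 1/t >= 1, on the slit. Hence the principal power of 1 - zt stays off its branch
  cut.\<close>

lemma one_minus_mult_not_nonpos_Reals: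
  assumes "z \<in> slit_plane" "0 \<le> t" "t \<le> 1"
  shows "1 - z * of_real t \<notin> \<real>\<^sub>\<le>\<^sub>0"
proof
  assume "1 - z * of_real t \<in> \<real>\<^sub>\<le>\<^sub>0"
  then have *: "1 \<le> Re z * t" "Im z * t = 0"
    by (auto simp: complex_nonpos_Reals_iff)
  then have "t \<noteq> 0" by auto
  with * have "Im z = 0" by simp
  moreover have "1 \<le> Re z"
  proof (rule ccontr)
    assume "\<not> 1 \<le> Re z"
    then have "Re z * t < 1 * t"
      using assms \<open>t \<noteq> 0\<close> by (intro mult_strict_right_mono) auto
    then show False using * assms by simp
  qed
  ultimately show False
    using assms by (auto simp: slit_plane_altdef)
qed

text \<open>The power is jointly continuous on the compact set \<open>K \<times> {0..1}\<close>.
  Including the endpoints of [0, 1] is what makes the bound uniform in t.\<close>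

lemma one_minus_mult_powr_bounded:
  assumes "compact K" "K \<subseteq> slit_plane"
  obtains B where "\<And>z t. z \<in> K \<Longrightarrow> 0 \<le> t \<Longrightarrow> t \<le> 1 \<Longrightarrow> norm ((1 - z * of_real t) powr a) \<le> B"
proof -
  have "continuous_on (K \<times> {0..1}) (\<lambda>(z, t). (1 - z * of_real t) powr a)"
    unfolding case_prod_beta
  proof (intro continuous_on_powr_complex continuous_intros)
    have nonpos: "1 - fst x * of_real (snd x) \<notin> \<real>\<^sub>\<le>\<^sub>0" if "x \<in> K \<times> {0..1}" for x
      using that assms(2) by (intro one_minus_mult_not_nonpos_Reals) auto
    show "K \<times> {0..1} \<subseteq> {x. Re (1 - fst x * of_real (snd x)) \<ge> 0 \<or> Im (1 - fst x * of_real (snd x)) \<noteq> 0}"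
      using nonpos by (force simp only: complex_nonpos_Reals_iff)
    \<comment> \<open>A complex power is continuous at base 0 only under a condition on the
      exponent; the base omits 0 here, so the case is contradictory.\<close>
    show "Re a > 0" if "x \<in> K \<times> {0..1}" "1 - fst x * of_real (snd x) = 0" for x
      using nonpos[OF that(1)] that(2) by simp
  qed
  then have "compact ((\<lambda>(z, t). (1 - z * of_real t) powr a) ` (K \<times> {0..1}))"
    using assms(1) by (intro compact_continuous_image compact_Times) auto
  then obtain B where "\<And>y. y \<in> (\<lambda>(z, t). (1 - z * of_real t) powr a) ` (K \<times> {0..1}) \<Longrightarrow> norm y \<le> B"
    using compact_imp_bounded bounded_iff by metis
  then show ?thesis
    by (intro that[of B]) force
qed

text \<open>The local majorant is the real Beta integrand times the bound \<open>B\<close> of the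
  last factor on a closed disc inside the slit plane.\<close>

lemma holomorphic_on_Euler_integral:
  fixes a p q :: complex
  assumes "Re p > 0" "Re q > 0"
  shows "(\<lambda>z. LINT t:{0<..<1}|lborel.
           of_real t powr (p - 1) * of_real (1 - t) powr (q - 1) * (1 - z * of_real t) powr (- a))
           holomorphic_on slit_plane"
  unfolding set_lebesgue_integral_def
proof (rule holomorphic_on_integral, goal_cases)
  case (1 z)
  show ?case by measurable
next
  case (2 t)
  show ?case
    by (cases "t \<in> {0<..<1}")
       (auto intro!: holomorphic_intros dest: one_minus_mult_not_nonpos_Reals[OF _ less_imp_le less_imp_le])
next
  case (3 z)
  obtain r where r: "r > 0" "cball z r \<subseteq> slit_plane"
    using 3 open_slit_plane open_contains_cball by blast
  obtain B where B: "\<And>w t. w \<in> cball z r \<Longrightarrow> 0 \<le> t \<Longrightarrow> t \<le> 1 \<Longrightarrow> norm ((1 - w * of_real t) powr (- a)) \<le> B"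
    using one_minus_mult_powr_bounded[OF compact_cball r(2)] by blast
  show ?case
  proof (intro exI conjI ballI)
    show "integrable lborel (\<lambda>t. (indicator {0<..<1} t *\<^sub>R (t powr (Re p - 1) * (1 - t) powr (Re q - 1))) * B)"
      using integrable_Beta_Ioo[OF assms] unfolding set_integrable_def by (rule integrable_mult_left)
    fix w t assume w: "w \<in> cball z r"
    show "norm (indicator {0<..<1} t *\<^sub>R (complex_of_real t powr (p - 1) * complex_of_real (1 - t) powr (q - 1) * (1 - w * of_real t) powr (- a)))
        \<le> (indicator {0<..<1} t *\<^sub>R (t powr (Re p - 1) * (1 - t) powr (Re q - 1))) * B"
      using B[OF w]
      by (auto simp: indicator_def norm_mult norm_powr_real_powr intro!: mult_left_mono)
  qed fact+
qed

text \<open>Holomorphy of the integral does not by itself record that the integrand is integrable;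
  the same majorant, with the compact set shrunk to {z}, supplies this.\<close>

lemma integrable_Euler_integral:
  fixes a p q :: complex
  assumes "Re p > 0" "Re q > 0" "z \<in> slit_plane"
  shows "set_integrable lborel {0<..<1} (\<lambda>t.
           of_real t powr (p - 1) * of_real (1 - t) powr (q - 1) * (1 - z * of_real t) powr (- a))"
proof -
  obtain B where B: "\<And>t. 0 \<le> t \<Longrightarrow> t \<le> 1 \<Longrightarrow> norm ((1 - z * of_real t) powr (- a)) \<le> B"
    using one_minus_mult_powr_bounded[of "{z}" "-a"] assms(3) by (metis compact_sing empty_subsetI insert_subset singletonI)
  have "integrable lborel (\<lambda>t. (indicator {0<..<1} t *\<^sub>R (t powr (Re p - 1) * (1 - t) powr (Re q - 1))) * B)"
    using integrable_Beta_Ioo[OF assms(1,2)] unfolding set_integrable_def by (rule integrable_mult_left)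
  then show ?thesis
    unfolding set_integrable_def
  proof (rule Bochner_Integration.integrable_bound)
    show "AE t in lborel.
        norm (indicator {0<..<1} t *\<^sub>R (complex_of_real t powr (p - 1) * complex_of_real (1 - t) powr (q - 1) * (1 - z * of_real t) powr (- a)))
        \<le> norm ((indicator {0<..<1} t *\<^sub>R (t powr (Re p - 1) * (1 - t) powr (Re q - 1))) * B)"
    proof (rule AE_I2)
      fix t :: real
      show "norm (indicator {0<..<1} t *\<^sub>R (complex_of_real t powr (p - 1) * complex_of_real (1 - t) powr (q - 1) * (1 - z * of_real t) powr (- a)))
        \<le> norm ((indicator {0<..<1} t *\<^sub>R (t powr (Re p - 1) * (1 - t) powr (Re q - 1))) * B)"
      proof (cases "t \<in> {0<..<1}")
        case True
        then have "norm ((1 - z * of_real t) powr (- a)) \<le> \<bar>B\<bar>"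
          by (intro order.trans[OF B abs_ge_self]) auto
        then show ?thesis
          using True by (simp add: norm_mult norm_powr_real_powr abs_mult mult_left_mono)
      qed simp
    qed
  qed measurable
qed

section \<open>Euler's integral as a hypergeometric series in the unit disc\<close>

text \<open>Each Gamma quotient is a Pochhammer symbol. This is where the factors
  \<open>pochhammer p n\<close> and \<open>pochhammer (p + q) n\<close> of the series come
  from.\<close>

lemma Beta_add_of_nat:
  fixes p q :: complex
  assumes "Re p > 0" "Re q > 0"
  shows "Beta (p + of_nat n) q = pochhammer p n / pochhammer (p + q) n * Beta p q"
proof -
  have "p \<notin> \<int>\<^sub>\<le>\<^sub>0" "p + q \<notin> \<int>\<^sub>\<le>\<^sub>0" "Gamma p \<noteq> 0" "Gamma (p + q) \<noteq> 0"
    using assms by (simp_all add: Re_pos_not_nonpos_Ints Gamma_nonzero_right_halfplane)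
  moreover have eq: "p + of_nat n + q = p + q + of_nat n"
    by (simp only: add_ac)
  ultimately show ?thesis
    unfolding Beta_def eq by (simp add: pochhammer_Gamma)
qed

lemma Euler_integral_power_series:
  fixes a p q :: complex
  assumes p: "Re p > 0" and q: "Re q > 0" and z: "norm z < 1"
  shows "(LINT t:{0<..<1}|lborel.
           of_real t powr (p - 1) * of_real (1 - t) powr (q - 1) * (1 - z * of_real t) powr (- a)) =
         Beta p q * eval_fps (fps_hypergeo [a, p] [p + q] 1) z"
proof -
  define C where "C = (\<lambda>n. pochhammer a n / fact n * z ^ n)"
  \<comment> \<open>\<open>f n\<close> is the n-th term of the binomial expansion of the integrand,
    with t^n absorbed into the power of t, so that its integral is \<open>C n\<close> times a Beta
    value at \<open>p + of_nat n\<close>.\<close>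
  define f where "f = (\<lambda>n t. C n * (indicator {0<..<1} t *\<^sub>R
    (complex_of_real t powr (p + of_nat n - 1) * of_real (1 - t) powr (q - 1))))"
  \<comment> \<open>The signs (-1)^n from the binomial coefficient and from (-z)^n cancel. This form
    gives access to the radius of convergence and the sum of the binomial series.\<close>
  have C_eq: "C n = ((- a) gchoose n) * (- z) ^ n" for n
    using power_mult_distrib[of "-1" "- z" n] by (simp add: C_def gbinomial_pochhammer)
  have sC: "summable (\<lambda>n. norm (C n))"
    unfolding C_eq using z
    by (intro abs_summable_in_conv_radius) (auto simp: conv_radius_gchoose)
  have int: "integrable lborel (f n)" for n
    using integrable_Beta_complex[of "p + of_nat n" q] p q
    unfolding f_def set_integrable_def by (intro integrable_mult_right) auto
  have f_eq: "f n t = C n * of_real t ^ n * (complex_of_real t powr (p - 1) * of_real (1 - t) powr (q - 1))"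
    if "t \<in> {0<..<1}" for n t
  proof -
    have "complex_of_real t powr (p + of_nat n - 1) = of_real t powr (p - 1) * of_real t ^ n"
      using that powr_add[of "complex_of_real t" "p - 1" "of_nat n"] by (simp add: algebra_simps powr_nat')
    then show ?thesis using that by (simp add: f_def)
  qed
  have f_0: "f n t = 0" if "t \<notin> {0<..<1}" for n t
    using that by (simp add: f_def)
  \<comment> \<open>\<open>h\<close> is the norm of the Beta integrand. As t^n <= 1,
    \<open>norm (C n) * h t\<close> bounds the n-th term, so absolute summability of
    \<open>C\<close> yields both the pointwise and the integrated summability required for termwise
    integration.\<close>
  define h where "h = (\<lambda>t. indicator {0<..<1} t *\<^sub>R (t powr (Re p - 1) * (1 - t) powr (Re q - 1)))"
  have h: "integrable lborel h"
    using integrable_Beta_Ioo[OF p q] unfolding set_integrable_def h_def .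
  have h_nonneg: "h t \<ge> 0" for t
    by (auto simp: h_def indicator_def)
  have norm_f: "norm (f n t) \<le> norm (C n) * h t" for n t
  proof (cases "t \<in> {0<..<1}")
    case True
    then have "norm (f n t) = norm (C n) * t ^ n * h t"
      by (simp add: f_eq norm_mult norm_power norm_powr_real_powr h_def)
    also have "\<dots> \<le> norm (C n) * 1 * h t"
      using True h_nonneg[of t] by (intro mult_right_mono mult_left_mono power_le_one) auto
    finally show ?thesis by simp
  qed (use h_nonneg[of t] in \<open>simp add: f_0\<close>)
  have "(\<lambda>n. integral\<^sup>L lborel (f n)) sums (\<integral>t. (\<Sum>n. f n t) \<partial>lborel)"
  proof (rule sums_integral[OF int])
    show "AE t in lborel. summable (\<lambda>n. norm (f n t))"
    proof (rule AE_I2)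
      fix t
      show "summable (\<lambda>n. norm (f n t))"
        by (rule summable_comparison_test'[OF summable_mult2[OF sC, of "h t"], of 0]) (simp add: norm_f)
    qed
    show "summable (\<lambda>n. \<integral>t. norm (f n t) \<partial>lborel)"
    proof (rule summable_comparison_test'[OF summable_mult2[OF sC, of "integral\<^sup>L lborel h"], of 0])
      fix n
      have "(\<integral>t. norm (f n t) \<partial>lborel) \<le> (\<integral>t. norm (C n) * h t \<partial>lborel)"
        using int h norm_f by (intro integral_mono) auto
      then show "norm (\<integral>t. norm (f n t) \<partial>lborel) \<le> norm (C n) * integral\<^sup>L lborel h"
        using h by simp
    qed
  qed
  also have "(\<integral>t. (\<Sum>n. f n t) \<partial>lborel) = (LINT t:{0<..<1}|lborel.
           of_real t powr (p - 1) * of_real (1 - t) powr (q - 1) * (1 - z * of_real t) powr (- a))"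
    unfolding set_lebesgue_integral_def
  proof (rule Bochner_Integration.integral_cong[OF refl])
    fix t :: real
    show "(\<Sum>n. f n t) = indicator {0<..<1} t *\<^sub>R
      (of_real t powr (p - 1) * of_real (1 - t) powr (q - 1) * (1 - z * of_real t) powr (- a))"
    proof (cases "t \<in> {0<..<1}")
      case True
      have "norm (- z * of_real t) < 1"
        using True z mult_left_le[of t "norm z"] by (simp add: norm_mult)
      from gen_binomial_complex[OF this, of "- a"]
      have "(\<lambda>n. C n * of_real t ^ n) sums (1 - z * of_real t) powr (- a)"
        unfolding C_eq power_mult_distrib by (simp add: mult.assoc)
      from sums_mult2[OF this] have "(\<lambda>n. f n t) sums ((1 - z * of_real t) powr (- a) *
         (complex_of_real t powr (p - 1) * of_real (1 - t) powr (q - 1)))"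
        by (simp add: f_eq[OF True])
      then show ?thesis
        using True by (simp add: sums_iff mult_ac)
    qed (simp add: f_0)
  qed
  also have "(\<lambda>n. integral\<^sup>L lborel (f n)) = (\<lambda>n. Beta p q *
      (pochhammer a n * pochhammer p n / (pochhammer (p + q) n * fact n) * z ^ n))"
  proof
    fix n
    have "integral\<^sup>L lborel (f n) = C n * Beta (p + of_nat n) q"
      unfolding f_def integral_mult_right_zero
      using set_integral_Beta[of "p + of_nat n" q] p q by (simp add: set_lebesgue_integral_def)
    then show "integral\<^sup>L lborel (f n) = Beta p q *
      (pochhammer a n * pochhammer p n / (pochhammer (p + q) n * fact n) * z ^ n)"
      using p q by (simp add: Beta_add_of_nat C_def mult_ac)
  qed
  finally have s: "(\<lambda>n. Beta p q *
      (pochhammer a n * pochhammer p n / (pochhammer (p + q) n * fact n) * z ^ n)) sums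
    (LINT t:{0<..<1}|lborel.
       of_real t powr (p - 1) * of_real (1 - t) powr (q - 1) * (1 - z * of_real t) powr (- a))" .
  \<comment> \<open>Summability is known for the series multiplied by \<open>Beta p q\<close>;
    cancelling this nonzero constant gives it for the hypergeometric series, so the constant can be
    pulled out of the sum.\<close>
  have "Beta p q \<noteq> 0"
    using p q by (simp add: Beta_def Gamma_nonzero_right_halfplane)
  then have "summable (\<lambda>n. pochhammer a n * pochhammer p n / (pochhammer (p + q) n * fact n) * z ^ n)"
    using sums_summable[OF s] by (simp only: summable_cmult_iff) simp
  then show ?thesis
    unfolding eval_fps_hypergeo_2_1 by (rule trans[OF sums_unique[OF s] suminf_mult])
qed

text \<open>The right-hand side is holomorphic on the slit plane and equals the series in the disc,
  the prefactor being 1 / Beta(b, c - b). It is therefore a continuation, and uniqueness identifies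
  it with the chosen one.\<close>

lemma gauss_2F1_Euler_integral:
  fixes a b c z :: complex
  assumes "Re c > Re b" "Re b > 0" "z \<in> slit_plane"
  shows "gauss_2F1 a b c z = Gamma c / (Gamma b * Gamma (c - b)) *
    (LINT t:{0<..<1}|lborel.
       of_real t powr (b - 1) * of_real (1 - t) powr (c - b - 1) * (1 - z * of_real t) powr (- a))"
proof (rule gauss_2F1_eqI[OF _ _ assms(3)])
  show "(\<lambda>z. Gamma c / (Gamma b * Gamma (c - b)) *
    (LINT t:{0<..<1}|lborel.
       of_real t powr (b - 1) * of_real (1 - t) powr (c - b - 1) * (1 - z * of_real t) powr (- a)))
     holomorphic_on slit_plane"
    using assms by (intro holomorphic_intros holomorphic_on_Euler_integral) auto
  fix z :: complex assume z: "norm z < 1"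
  have "Gamma c \<noteq> 0" "Gamma b \<noteq> 0" "Gamma (c - b) \<noteq> 0"
    using assms by (simp_all add: Gamma_nonzero_right_halfplane)
  then show "Gamma c / (Gamma b * Gamma (c - b)) *
    (LINT t:{0<..<1}|lborel.
       of_real t powr (b - 1) * of_real (1 - t) powr (c - b - 1) * (1 - z * of_real t) powr (- a)) =
     eval_fps (fps_hypergeo [a, b] [c] 1) z"
    using Euler_integral_power_series[of b "c - b" z a] assms z by (simp add: Beta_def)
qed

text \<open>The series is symmetric in the upper parameters, so both choices are made from the same
  predicate. Needed where the Beta parameter of Euler's integral stands first, as in
  \<open>hyp_w2\<close> and \<open>hyp_w4\<close>.\<close>

lemma gauss_2F1_commute: "gauss_2F1 a b c = gauss_2F1 b a c"
  unfolding gauss_2F1_def eval_fps_hypergeo_2_1 by (simp only: mult.commute)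

section \<open>Power arithmetic and transport of Euler's formula along a substitution\<close>

lemma of_real_powr_conv_exp: "r > 0 \<Longrightarrow> complex_of_real r powr z = exp (z * of_real (ln r))"
  by (simp add: powr_def Ln_of_real)

text \<open>Collapses a product of complex powers of positive reals into one exponential, so that an
  identity of powers becomes a linear identity in logarithms. The order facts discharge the side
  conditions.\<close>

lemmas powr_to_exp = of_real_powr_conv_exp ln_div ln_mult ln_realpow ln_one exp_add[symmetric]
  mult_pos_pos divide_pos_pos zero_less_power zero_less_one order_less_imp_not_eq2
  not_False_eq_True mult_1_left

text \<open>The common frame of all six cases: what remains for each is the bijection
  \<open>g\<close>, its derivative, and the pointwise identity \<open>eq\<close>. \<open>K\<close>
  collects the power of |x| or |1 - x| in front; positivity of 1 - zt is available in
  \<open>eq\<close> because z < 1.\<close>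

lemma gauss_2F1_integral_substitution:
  fixes a p q K :: complex and f :: "real \<Rightarrow> complex" and g h :: "real \<Rightarrow> real"
  assumes p: "Re p > 0" and q: "Re q > 0" and z: "z < 1"
    and g: "bij_betw g {0<..<1} T" and T: "T \<in> sets borel"
    and f: "f \<in> borel_measurable borel"
    and der: "\<And>t. 0 < t \<Longrightarrow> t < 1 \<Longrightarrow> (g has_real_derivative h t) (at t)"
    and eq: "\<And>t. 0 < t \<Longrightarrow> t < 1 \<Longrightarrow> 0 < 1 - z * t \<Longrightarrow> of_real \<bar>h t\<bar> * f (g t) =
        K * (of_real t powr (p - 1) * of_real (1 - t) powr (q - 1) * of_real (1 - z * t) powr (- a))"
  shows "set_integrable lborel T f"
    and "K * gauss_2F1 a p (p + q) (of_real z) = Gamma (p + q) / (Gamma p * Gamma q) * (LINT y:T|lborel. f y)"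
proof -
  have zs: "complex_of_real z \<in> slit_plane"
    using z by (simp add: slit_plane_altdef)
  let ?k = "\<lambda>t. of_real t powr (p - 1) * of_real (1 - t) powr (q - 1) *
     (1 - complex_of_real z * of_real t) powr (- a)"
  have int: "set_integrable lborel {0<..<1} ?k"
    using integrable_Euler_integral[OF p q zs] .
  have pos: "0 < 1 - z * t" if "0 < t" "t < 1" for t
  proof (cases "z \<le> 0")
    case True
    then show ?thesis using that mult_nonpos_nonneg[of z t] by simp
  next
    case False
    then show ?thesis using that z mult_strict_mono[of z 1 t 1] by simp
  qed
  have Kint: "set_integrable lborel {0<..<1} (\<lambda>t. K * ?k t)"
    using int by (rule set_integrable_mult_right)
  have Keq: "of_real \<bar>h t\<bar> * f (g t) = K * ?k t" if "t \<in> {0<..<1}" for t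
    using eq[of t] pos[of t] that by simp
  note subst = set_integral_substitution[of "{0<..<1}" g T f h, OF _ _ T f _ _ Keq Kint]
  have *: "(LINT y:T|lborel. f y) = (LINT t:{0<..<1}|lborel. K * ?k t)"
    using g unfolding bij_betw_def by (intro subst) (auto intro!: der)
  show "set_integrable lborel T f"
    using g unfolding bij_betw_def by (intro subst) (auto intro!: der)
  show "K * gauss_2F1 a p (p + q) (of_real z) = Gamma (p + q) / (Gamma p * Gamma q) * (LINT y:T|lborel. f y)"
    using * gauss_2F1_Euler_integral[of p "p + q" "of_real z" a] p q zs by simp
qed

section \<open>The six integral representations\<close>

text \<open>With y = 1/t one has y - 1 = (1 - t)/t and y - x = (1 - xt)/t; together with the
  Jacobian the powers of t add up to b - 1. Here p = b, q = c - b, z = x.\<close>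

lemma hyp_w1_integral:
  fixes x :: real and a b c :: complex
  assumes "x < 1" "Re c > Re b" "Re b > 0"
  defines "f \<equiv> \<lambda>y. complex_of_real y powr (a - c) * complex_of_real (y - 1) powr (c - b - 1) *
              complex_of_real (y - x) powr (- a)"
  shows "set_integrable lborel {1<..} f"
    and "hyp_w1 x a b c = Gamma c / (Gamma b * Gamma (c - b)) * (LINT y:{1<..}|lborel. f y)"
proof -
  note z = assms(1)
  have bij: "bij_betw (\<lambda>t. 1 / t) {0<..<1} {1::real<..}"
    by (rule bij_betw_byWitness[where f' = "\<lambda>y. 1 / y"]) auto
  have f: "f \<in> borel_measurable borel"
    unfolding f_def by measurable
  \<comment> \<open>The Jacobian is written as a power with exponent 1 so that
    \<open>powr_to_exp\<close> treats it like the other factors; \<open>u\<close> and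
    \<open>v\<close> stand for 1 - t and 1 - xt.\<close>
  have powr: "of_real (1 / t\<^sup>2) powr 1 *
      (of_real (1 / t) powr (a - c) * of_real (u / t) powr (c - b - 1) * of_real (v / t) powr (- a)) =
      1 * (of_real t powr (b - 1) * of_real u powr ((c - b) - 1) * of_real v powr (- a))"
    if "t > 0" "u > 0" "v > 0" for t u v :: real
    using that
    by (simp only: powr_to_exp; intro arg_cong[of _ _ exp]; simp add: algebra_simps)
  have eq: "of_real \<bar>(- (1 / t\<^sup>2))\<bar> * f (1 / t) =
      1 * (of_real t powr (b - 1) * of_real (1 - t) powr ((c - b) - 1) * of_real (1 - x * t) powr (- a))"
    if t: "0 < t" "t < 1" "0 < 1 - x * t" for t
  proof -
    have "1 / t - 1 = (1 - t) / t"
      and "1 / t - x = (1 - x * t) / t"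
      and "\<bar>- (1 / t\<^sup>2)\<bar> = 1 / t\<^sup>2"
      using t by (auto simp: field_simps)
    then show ?thesis
      using powr[of t "1 - t" "1 - x * t"] t unfolding f_def by simp
  qed
  have der: "((\<lambda>t. 1 / t) has_real_derivative (- (1 / t\<^sup>2))) (at t)" if "0 < t" for t
    using that by (auto intro!: derivative_eq_intros simp: power2_eq_square)
  have T: "{1::real<..} \<in> sets borel"
    by measurable
  note * = gauss_2F1_integral_substitution[OF _ _ z bij T f der eq]
  show "set_integrable lborel {1<..} f"
    using assms by (intro *(1)) auto
  show "hyp_w1 x a b c = Gamma c / (Gamma b * Gamma (c - b)) * (LINT y:{1<..}|lborel. f y)"
    using *(2) assms unfolding hyp_w1_def by simp
qed

text \<open>y = xt covers both signs of x. The factor 1 - y becomes 1 - zt with z = x, while |x - y|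
  = |x|(1 - t); p = a - c + 1 and q = 1 - a.\<close>

lemma hyp_w2_integral:
  fixes x :: real and a b c :: complex
  assumes x: "x < 0 \<or> 0 < x \<and> x < 1" and "2 > Re (a + 1)" "Re (a + 1) > Re c"
  defines "f \<equiv> \<lambda>y. complex_of_real \<bar>y\<bar> powr (a - c) * complex_of_real (1 - y) powr (c - b - 1) *
              complex_of_real \<bar>x - y\<bar> powr (- a)"
  shows "set_integrable lborel {y. 0 < y / x \<and> y / x < 1} f"
    and "hyp_w2 x a b c = Gamma (2 - c) / (Gamma (a - c + 1) * Gamma (1 - a)) * (LINT y:{y. 0 < y / x \<and> y / x < 1}|lborel. f y)"
proof -
  have z: "x < 1" and X: "\<bar>x\<bar> > 0"
    using x by auto
  have bij: "bij_betw (\<lambda>t. x * t) {0<..<1} {y. 0 < y / x \<and> y / x < 1}"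
    by (rule bij_betw_byWitness[where f' = "\<lambda>y. y / x"]) (use x in auto)
  have f: "f \<in> borel_measurable borel"
    unfolding f_def by measurable
  have powr: "of_real \<bar>x\<bar> powr 1 *
      (of_real (\<bar>x\<bar> * t) powr (a - c) * of_real v powr (c - b - 1) * of_real (\<bar>x\<bar> * u) powr (- a)) =
      of_real \<bar>x\<bar> powr (1 - c) * (of_real t powr ((a - c + 1) - 1) * of_real u powr ((1 - a) - 1) * of_real v powr (- (b - c + 1)))"
    if "t > 0" "u > 0" "v > 0" for t u v :: real
    using that X
    by (simp only: powr_to_exp; intro arg_cong[of _ _ exp]; simp add: algebra_simps)
  have eq: "of_real \<bar>x\<bar> * f (x * t) =
      of_real \<bar>x\<bar> powr (1 - c) * (of_real t powr ((a - c + 1) - 1) * of_real (1 - t) powr ((1 - a) - 1) * of_real (1 - x * t) powr (- (b - c + 1)))"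
    if t: "0 < t" "t < 1" "0 < 1 - x * t" for t
  proof -
    have "\<bar>x * t\<bar> = \<bar>x\<bar> * t"
      and "\<bar>x - x * t\<bar> = \<bar>x\<bar> * (1 - t)"
      using t abs_mult[of x "1 - t"] by (auto simp: abs_mult algebra_simps)
    then show ?thesis
      using powr[of t "1 - t" "1 - x * t"] t unfolding f_def by simp
  qed
  have der: "((\<lambda>t. x * t) has_real_derivative x) (at t)" if "0 < t" for t
    using that by (auto intro!: derivative_eq_intros simp: power2_eq_square)
  have T: "{y. 0 < y / x \<and> y / x < 1} \<in> sets borel"
    by measurable
  note * = gauss_2F1_integral_substitution[OF _ _ z bij T f der eq]
  show "set_integrable lborel {y. 0 < y / x \<and> y / x < 1} f"
    using assms by (intro *(1)) auto
  show "hyp_w2 x a b c = Gamma (2 - c) / (Gamma (a - c + 1) * Gamma (1 - a)) * (LINT y:{y. 0 < y / x \<and> y / x < 1}|lborel. f y)"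
    using *(2) assms unfolding hyp_w2_def gauss_2F1_commute[of "a - c + 1"] by (simp add: algebra_simps)
qed

text \<open>No change of variable: |x - t| = |x|(1 - t/x) already shows Euler's integrand with z =
  1/x, p = a - c + 1, q = c - b.\<close>

lemma hyp_w3_integral:
  fixes x :: real and a b c :: complex
  assumes x: "x < 0 \<or> 1 < x" and "Re (a + 1) > Re c" "Re c > Re b"
  defines "f \<equiv> \<lambda>y. complex_of_real y powr (a - c) * complex_of_real (1 - y) powr (c - b - 1) *
              complex_of_real \<bar>x - y\<bar> powr (- a)"
  shows "set_integrable lborel {0<..<1} f"
    and "hyp_w3 x a b c = Gamma (a - b + 1) / (Gamma (a - c + 1) * Gamma (c - b)) * (LINT y:{0<..<1}|lborel. f y)"
proof -
  have z: "inverse x < 1" and X: "\<bar>x\<bar> > 0"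
    using x by (auto simp: field_simps)
  have bij: "bij_betw (\<lambda>t. t) {0<..<1} {0<..<1}"
    by (rule bij_betw_byWitness[where f' = "\<lambda>y. y"]) auto
  have f: "f \<in> borel_measurable borel"
    unfolding f_def by measurable
  have powr: "of_real t powr (a - c) * of_real u powr (c - b - 1) * of_real (\<bar>x\<bar> * v) powr (- a) =
      of_real \<bar>x\<bar> powr (- a) * (of_real t powr ((a - c + 1) - 1) * of_real u powr ((c - b) - 1) * of_real v powr (- a))"
    if "t > 0" "u > 0" "v > 0" for t u v :: real
    using that X
    by (simp only: powr_to_exp; intro arg_cong[of _ _ exp]; simp add: algebra_simps)
  have eq: "of_real \<bar>1\<bar> * f (t) =
      of_real \<bar>x\<bar> powr (- a) * (of_real t powr ((a - c + 1) - 1) * of_real (1 - t) powr ((c - b) - 1) * of_real (1 - inverse x * t) powr (- a))"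
    if t: "0 < t" "t < 1" "0 < 1 - inverse x * t" for t
  proof -
    have "\<bar>x - t\<bar> = \<bar>x\<bar> * (1 - inverse x * t)"
      using t x abs_mult[of x "1 - inverse x * t"] by (auto simp: algebra_simps)
    then show ?thesis
      using powr[of t "1 - t" "1 - inverse x * t"] t unfolding f_def by simp
  qed
  have der: "((\<lambda>t. t) has_real_derivative 1) (at t)" if "0 < t" for t
    using that by (auto intro!: derivative_eq_intros simp: power2_eq_square)
  have T: "{0<..<1::real} \<in> sets borel"
    by measurable
  note * = gauss_2F1_integral_substitution[OF _ _ z bij T f der eq]
  show "set_integrable lborel {0<..<1} f"
    using assms by (intro *(1)) auto
  show "hyp_w3 x a b c = Gamma (a - b + 1) / (Gamma (a - c + 1) * Gamma (c - b)) * (LINT y:{0<..<1}|lborel. f y)"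
    using *(2) assms unfolding hyp_w3_def by (simp add: algebra_simps)
qed

text \<open>Under y = x/t the factor |y - 1| yields 1 - t/x and |y - x| yields 1 - t, so z = 1/x, p
  = b, q = 1 - a; the powers of |x| add up to -b.\<close>

lemma hyp_w4_integral:
  fixes x :: real and a b c :: complex
  assumes x: "x < 0 \<or> 1 < x" and "Re a < 1" "Re b > 0"
  defines "f \<equiv> \<lambda>y. complex_of_real \<bar>y\<bar> powr (a - c) * complex_of_real \<bar>y - 1\<bar> powr (c - b - 1) *
              complex_of_real \<bar>y - x\<bar> powr (- a)"
  shows "set_integrable lborel {y. y / x > 1} f"
    and "hyp_w4 x a b c = Gamma (b - a + 1) / (Gamma (1 - a) * Gamma b) * (LINT y:{y. y / x > 1}|lborel. f y)"
proof -
  have z: "inverse x < 1" and X: "\<bar>x\<bar> > 0"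
    using x by (auto simp: field_simps)
  have bij: "bij_betw (\<lambda>t. x / t) {0<..<1} {y. y / x > 1}"
    by (rule bij_betw_byWitness[where f' = "\<lambda>y. x / y"]) (use x in \<open>auto simp: field_simps\<close>)
  have f: "f \<in> borel_measurable borel"
    unfolding f_def by measurable
  have powr: "of_real (\<bar>x\<bar> / t\<^sup>2) powr 1 *
      (of_real (\<bar>x\<bar> / t) powr (a - c) * of_real (\<bar>x\<bar> * v / t) powr (c - b - 1) * of_real (\<bar>x\<bar> * u / t) powr (- a)) =
      of_real \<bar>x\<bar> powr (- b) * (of_real t powr (b - 1) * of_real u powr ((1 - a) - 1) * of_real v powr (- (b - c + 1)))"
    if "t > 0" "u > 0" "v > 0" for t u v :: real
    using that X
    by (simp only: powr_to_exp; intro arg_cong[of _ _ exp]; simp add: algebra_simps)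
  have eq: "of_real \<bar>(- (x / t\<^sup>2))\<bar> * f (x / t) =
      of_real \<bar>x\<bar> powr (- b) * (of_real t powr (b - 1) * of_real (1 - t) powr ((1 - a) - 1) * of_real (1 - inverse x * t) powr (- (b - c + 1)))"
    if t: "0 < t" "t < 1" "0 < 1 - inverse x * t" for t
  proof -
    have "\<bar>x / t\<bar> = \<bar>x\<bar> / t"
      and "\<bar>x / t - 1\<bar> = \<bar>x\<bar> * (1 - inverse x * t) / t"
      and "\<bar>x / t - x\<bar> = \<bar>x\<bar> * (1 - t) / t"
      and "\<bar>- (x / t\<^sup>2)\<bar> = \<bar>x\<bar> / t\<^sup>2"
      using t x abs_mult[of "x / t" "1 - inverse x * t"] abs_mult[of "x / t" "1 - t"] by (auto simp: abs_mult field_simps)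
    then show ?thesis
      using powr[of t "1 - t" "1 - inverse x * t"] t unfolding f_def by simp
  qed
  have der: "((\<lambda>t. x / t) has_real_derivative (- (x / t\<^sup>2))) (at t)" if "0 < t" for t
    using that by (auto intro!: derivative_eq_intros simp: power2_eq_square)
  have T: "{y. y / x > 1} \<in> sets borel"
    by measurable
  note * = gauss_2F1_integral_substitution[OF _ _ z bij T f der eq]
  show "set_integrable lborel {y. y / x > 1} f"
    using assms by (intro *(1)) auto
  show "hyp_w4 x a b c = Gamma (b - a + 1) / (Gamma (1 - a) * Gamma b) * (LINT y:{y. y / x > 1}|lborel. f y)"
    using *(2) assms unfolding hyp_w4_def gauss_2F1_commute[of b] by (simp add: algebra_simps)
qed

text \<open>y = 1 - 1/t gives -y = (1 - t)/t, 1 - y = 1/t and x - y = (1 - (1 - x)t)/t, so z = 1 -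
  x, p = b, q = a - c + 1.\<close>

lemma hyp_w5_integral:
  fixes x :: real and a b c :: complex
  assumes x: "0 < x" and "Re b > 0" "Re (a + 1) > Re c"
  defines "f \<equiv> \<lambda>y. complex_of_real (- y) powr (a - c) * complex_of_real (1 - y) powr (c - b - 1) *
              complex_of_real (x - y) powr (- a)"
  shows "set_integrable lborel {..<0} f"
    and "hyp_w5 x a b c = Gamma (a + b - c + 1) / (Gamma (a - c + 1) * Gamma b) * (LINT y:{..<0}|lborel. f y)"
proof -
  have z: "1 - x < 1"
    using x by simp
  have bij: "bij_betw (\<lambda>t. 1 - 1 / t) {0<..<1} {..<0::real}"
    by (rule bij_betw_byWitness[where f' = "\<lambda>y. 1 / (1 - y)"]) (auto simp: field_simps)
  have f: "f \<in> borel_measurable borel"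
    unfolding f_def by measurable
  have powr: "of_real (1 / t\<^sup>2) powr 1 *
      (of_real (u / t) powr (a - c) * of_real (1 / t) powr (c - b - 1) * of_real (v / t) powr (- a)) =
      1 * (of_real t powr (b - 1) * of_real u powr ((a - c + 1) - 1) * of_real v powr (- a))"
    if "t > 0" "u > 0" "v > 0" for t u v :: real
    using that
    by (simp only: powr_to_exp; intro arg_cong[of _ _ exp]; simp add: algebra_simps)
  have eq: "of_real \<bar>(1 / t\<^sup>2)\<bar> * f (1 - 1 / t) =
      1 * (of_real t powr (b - 1) * of_real (1 - t) powr ((a - c + 1) - 1) * of_real (1 - (1 - x) * t) powr (- a))"
    if t: "0 < t" "t < 1" "0 < 1 - (1 - x) * t" for t
  proof -
    have "- (1 - 1 / t) = (1 - t) / t"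
      and "1 - (1 - 1 / t) = 1 / t"
      and "x - (1 - 1 / t) = (1 - (1 - x) * t) / t"
      and "\<bar>1 / t\<^sup>2\<bar> = 1 / t\<^sup>2"
      using t by (auto simp: field_simps)
    then show ?thesis
      using powr[of t "1 - t" "1 - (1 - x) * t"] t unfolding f_def by simp
  qed
  have der: "((\<lambda>t. 1 - 1 / t) has_real_derivative (1 / t\<^sup>2)) (at t)" if "0 < t" for t
    using that by (auto intro!: derivative_eq_intros simp: power2_eq_square)
  have T: "{..<0::real} \<in> sets borel"
    by measurable
  note * = gauss_2F1_integral_substitution[OF _ _ z bij T f der eq]
  show "set_integrable lborel {..<0} f"
    using assms by (intro *(1)) auto
  show "hyp_w5 x a b c = Gamma (a + b - c + 1) / (Gamma (a - c + 1) * Gamma b) * (LINT y:{..<0}|lborel. f y)"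
    using *(2) assms unfolding hyp_w5_def by (simp add: algebra_simps)
qed

text \<open>With y = 1 - (1 - x)t the variable y itself is the positive factor 1 - zt, z = 1 - x; |1
  - y| and |x - y| are |1 - x| times t and 1 - t. Here p = c - b, q = 1 - a.\<close>

lemma hyp_w6_integral:
  fixes x :: real and a b c :: complex
  assumes x: "0 < x" "x \<noteq> 1" and "Re (c - b) > 0" "Re a < 1"
  defines "f \<equiv> \<lambda>y. complex_of_real \<bar>y\<bar> powr (a - c) * complex_of_real \<bar>1 - y\<bar> powr (c - b - 1) *
              complex_of_real \<bar>x - y\<bar> powr (- a)"
  shows "set_integrable lborel {y. 0 < (1 - y) / (1 - x) \<and> (1 - y) / (1 - x) < 1} f"
    and "hyp_w6 x a b c = Gamma (c - a - b + 1) / (Gamma (1 - a) * Gamma (c - b)) * (LINT y:{y. 0 < (1 - y) / (1 - x) \<and> (1 - y) / (1 - x) < 1}|lborel. f y)"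
proof -
  have z: "1 - x < 1" and X: "\<bar>1 - x\<bar> > 0"
    using x by auto
  have bij: "bij_betw (\<lambda>t. 1 - (1 - x) * t) {0<..<1} {y. 0 < (1 - y) / (1 - x) \<and> (1 - y) / (1 - x) < 1}"
    by (rule bij_betw_byWitness[where f' = "\<lambda>y. (1 - y) / (1 - x)"]) (use x in auto)
  have f: "f \<in> borel_measurable borel"
    unfolding f_def by measurable
  have powr: "of_real \<bar>1 - x\<bar> powr 1 *
      (of_real v powr (a - c) * of_real (\<bar>1 - x\<bar> * t) powr (c - b - 1) * of_real (\<bar>1 - x\<bar> * u) powr (- a)) =
      of_real \<bar>1 - x\<bar> powr (c - a - b) * (of_real t powr ((c - b) - 1) * of_real u powr ((1 - a) - 1) * of_real v powr (- (c - a)))"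
    if "t > 0" "u > 0" "v > 0" for t u v :: real
    using that X
    by (simp only: powr_to_exp; intro arg_cong[of _ _ exp]; simp add: algebra_simps)
  have eq: "of_real \<bar>(- (1 - x))\<bar> * f (1 - (1 - x) * t) =
      of_real \<bar>1 - x\<bar> powr (c - a - b) * (of_real t powr ((c - b) - 1) * of_real (1 - t) powr ((1 - a) - 1) * of_real (1 - (1 - x) * t) powr (- (c - a)))"
    if t: "0 < t" "t < 1" "0 < 1 - (1 - x) * t" for t
  proof -
    have "\<bar>1 - (1 - x) * t\<bar> = 1 - (1 - x) * t"
      and "\<bar>1 - (1 - (1 - x) * t)\<bar> = \<bar>1 - x\<bar> * t"
      and "\<bar>x - (1 - (1 - x) * t)\<bar> = \<bar>1 - x\<bar> * (1 - t)"
      and "\<bar>- (1 - x)\<bar> = \<bar>1 - x\<bar>"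
      using t abs_mult[of "1 - x" t] abs_mult[of "1 - x" "1 - t"] abs_minus_commute[of x "1 - (1 - x) * t"] by (auto simp: abs_mult algebra_simps)
    then show ?thesis
      using powr[of t "1 - t" "1 - (1 - x) * t"] t unfolding f_def by simp
  qed
  have der: "((\<lambda>t. 1 - (1 - x) * t) has_real_derivative (- (1 - x))) (at t)" if "0 < t" for t
    using that by (auto intro!: derivative_eq_intros simp: power2_eq_square)
  have T: "{y. 0 < (1 - y) / (1 - x) \<and> (1 - y) / (1 - x) < 1} \<in> sets borel"
    by measurable
  note * = gauss_2F1_integral_substitution[OF _ _ z bij T f der eq]
  show "set_integrable lborel {y. 0 < (1 - y) / (1 - x) \<and> (1 - y) / (1 - x) < 1} f"
    using assms by (intro *(1)) auto
  show "hyp_w6 x a b c = Gamma (c - a - b + 1) / (Gamma (1 - a) * Gamma (c - b)) * (LINT y:{y. 0 < (1 - y) / (1 - x) \<and> (1 - y) / (1 - x) < 1}|lborel. f y)"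
    using *(2) assms unfolding hyp_w6_def by (simp add: algebra_simps)
qed

text \<open>Integrability accompanies each equation because the Bochner integral of a non-integrable
  function is 0 by convention; the equation alone would not assert convergence.\<close>

theorem mainTheorem18:
  fixes a b c :: complex
  shows "(\<forall>x::real. x < 1 \<and> Re c > Re b \<and> Re b > 0 \<longrightarrow>
          set_integrable lborel {1<..} (\<lambda>y.
              complex_of_real y powr (a - c) * complex_of_real (y - 1) powr (c - b - 1) *
              complex_of_real (y - x) powr (- a)) \<and>
          hyp_w1 x a b c = Gamma c / (Gamma b * Gamma (c - b)) *
            (LINT y:{1<..}|lborel.
              complex_of_real y powr (a - c) * complex_of_real (y - 1) powr (c - b - 1) *
              complex_of_real (y - x) powr (- a))) \<and>
    (\<forall>x::real. x \<in> {..<0} \<union> {0<..<1} \<and> 2 > Re (a + 1) \<and> Re (a + 1) > Re c \<longrightarrow>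
          set_integrable lborel {y. 0 < y / x \<and> y / x < 1} (\<lambda>y.
              complex_of_real \<bar>y\<bar> powr (a - c) * complex_of_real (1 - y) powr (c - b - 1) *
              complex_of_real \<bar>x - y\<bar> powr (- a)) \<and>
          hyp_w2 x a b c = Gamma (2 - c) / (Gamma (a - c + 1) * Gamma (1 - a)) *
            (LINT y:{y. 0 < y / x \<and> y / x < 1}|lborel.
              complex_of_real \<bar>y\<bar> powr (a - c) * complex_of_real (1 - y) powr (c - b - 1) *
              complex_of_real \<bar>x - y\<bar> powr (- a))) \<and>
    (\<forall>x::real. x \<in> {..<0} \<union> {1<..} \<and> Re (a + 1) > Re c \<and> Re c > Re b \<longrightarrow>
          set_integrable lborel {0<..<1} (\<lambda>y.
              complex_of_real y powr (a - c) * complex_of_real (1 - y) powr (c - b - 1) *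
              complex_of_real \<bar>x - y\<bar> powr (- a)) \<and>
          hyp_w3 x a b c = Gamma (a - b + 1) / (Gamma (a - c + 1) * Gamma (c - b)) *
            (LINT y:{0<..<1}|lborel.
              complex_of_real y powr (a - c) * complex_of_real (1 - y) powr (c - b - 1) *
              complex_of_real \<bar>x - y\<bar> powr (- a))) \<and>
    (\<forall>x::real. x \<in> {..<0} \<union> {1<..} \<and> Re a < 1 \<and> Re b > 0 \<longrightarrow>
          set_integrable lborel {y. y / x > 1} (\<lambda>y.
              complex_of_real \<bar>y\<bar> powr (a - c) * complex_of_real \<bar>y - 1\<bar> powr (c - b - 1) *
              complex_of_real \<bar>y - x\<bar> powr (- a)) \<and>
          hyp_w4 x a b c = Gamma (b - a + 1) / (Gamma (1 - a) * Gamma b) *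
            (LINT y:{y. y / x > 1}|lborel.
              complex_of_real \<bar>y\<bar> powr (a - c) * complex_of_real \<bar>y - 1\<bar> powr (c - b - 1) *
              complex_of_real \<bar>y - x\<bar> powr (- a))) \<and>
    (\<forall>x::real. x \<in> {0<..} \<and> Re b > 0 \<and> Re (a + 1) > Re c \<longrightarrow>
          set_integrable lborel {..<0} (\<lambda>y.
              complex_of_real (- y) powr (a - c) * complex_of_real (1 - y) powr (c - b - 1) *
              complex_of_real (x - y) powr (- a)) \<and>
          hyp_w5 x a b c = Gamma (a + b - c + 1) / (Gamma (a - c + 1) * Gamma b) *
            (LINT y:{..<0}|lborel.
              complex_of_real (- y) powr (a - c) * complex_of_real (1 - y) powr (c - b - 1) *
              complex_of_real (x - y) powr (- a))) \<and>
    (\<forall>x::real. x \<in> {0<..<1} \<union> {1<..} \<and> Re (c - b) > 0 \<and> Re a < 1 \<longrightarrow>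
          set_integrable lborel {y. 0 < (1 - y) / (1 - x) \<and> (1 - y) / (1 - x) < 1} (\<lambda>y.
              complex_of_real \<bar>y\<bar> powr (a - c) * complex_of_real \<bar>1 - y\<bar> powr (c - b - 1) *
              complex_of_real \<bar>x - y\<bar> powr (- a)) \<and>
          hyp_w6 x a b c = Gamma (c - a - b + 1) / (Gamma (1 - a) * Gamma (c - b)) *
            (LINT y:{y. 0 < (1 - y) / (1 - x) \<and> (1 - y) / (1 - x) < 1}|lborel.
              complex_of_real \<bar>y\<bar> powr (a - c) * complex_of_real \<bar>1 - y\<bar> powr (c - b - 1) *
              complex_of_real \<bar>x - y\<bar> powr (- a)))"
  by (intro conjI allI impI; rule hyp_w1_integral hyp_w2_integral hyp_w3_integral
        hyp_w4_integral hyp_w5_integral hyp_w6_integral; auto)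

end
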